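(* Let $\mathcal{H}$ be a complex Hilbert space and let $S,T\in\mathcal{B}(\mathcal{H})$ be such that $S$, $T$ and $ST$ have closed ranges and $(ST)^\dagger=T^\dagger S^\dagger$. Then $ST$ and $TS$ are both $EP$ operators if and only if $S^\dagger ST=TSS^\dagger$ and $STT^\dagger=T^\dagger TS$.
   Context: $\mathcal{B}(\mathcal{H})$ is the space of bounded linear operators on $\mathcal{H}$; $\mathcal{R}(T)$ denotes the range of $T$ and $T^*$ its adjoint. For $T\in\mathcal{B}(\mathcal{H})$ with closed range, the Moore-Penrose inverse $T^\dagger$ is the unique operator in $\mathcal{B}(\mathcal{H})$ satisfying $TT^\dagger T=T$, $T^\dagger TT^\dagger=T^\dagger$, $TT^\dagger=(TT^\dagger)^*$ and $T^\dagger T=(T^\dagger T)^*$; it exists if and only if $T$ has closed range. An $EP$ operator on $\mathcal{H}$ is a $T\in\mathcal{B}(\mathcal{H})$ with closed range such that $\mathcal{R}(T)=\mathcal{R}(T^* )$ (so closedness of the range is part of the assertion that an operator is $EP$). *)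

theory Defs
  imports "HOL-Analysis.Analysis"
begin

class complex_vector = real_vector +
  fixes scaleC :: "complex \<Rightarrow> 'a \<Rightarrow> 'a"  (infixr \<open>*\<^sub>C\<close> 75)
  assumes scaleC_add_right: "c *\<^sub>C (x + y) = c *\<^sub>C x + c *\<^sub>C y"
    and scaleC_add_left: "(b + c) *\<^sub>C x = b *\<^sub>C x + c *\<^sub>C x"
    and scaleC_scaleC: "b *\<^sub>C (c *\<^sub>C x) = (b * c) *\<^sub>C x"
    and scaleC_one: "1 *\<^sub>C x = x"
    and scaleR_scaleC: "r *\<^sub>R x = complex_of_real r *\<^sub>C x"

text \<open>The inner product is linear in its first and conjugate-linear in its second argument.
  Building on the class \<open>real_normed_vector\<close> is redundant (its norm axioms follow from those of
  the inner product) but not restrictive; it supplies the library's topology and metric.\<close>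

class complex_inner = complex_vector + real_normed_vector +
  fixes cinner :: "'a \<Rightarrow> 'a \<Rightarrow> complex"
  assumes cinner_commute: "cinner x y = cnj (cinner y x)"
    and cinner_add_left: "cinner (x + y) z = cinner x z + cinner y z"
    and cinner_scaleC_left: "cinner (c *\<^sub>C x) y = c * cinner x y"
    and cinner_ge_zero: "0 \<le> Re (cinner x x)"
    and cinner_eq_zero_iff: "cinner x x = 0 \<longleftrightarrow> x = 0"
    and norm_eq_sqrt_cinner: "norm x = sqrt (Re (cinner x x))"

class chilbert_space = complex_inner + complete_space

instantiation complex :: chilbert_space
begin

definition scaleC_complex :: "complex \<Rightarrow> complex \<Rightarrow> complex"
  where "scaleC_complex c x = c * x"

definition cinner_complex :: "complex \<Rightarrow> complex \<Rightarrow> complex"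
  where "cinner_complex x y = x * cnj y"

instance
  by standard
    (auto simp: scaleC_complex_def cinner_complex_def algebra_simps scaleR_conv_of_real
      cmod_def power2_eq_square)

end

text \<open>\<open>bounded_linear\<close> only expresses linearity over the reals.\<close>

definition bounded_clinear :: "('a::complex_inner \<Rightarrow> 'b::complex_inner) \<Rightarrow> bool"
  where "bounded_clinear T \<longleftrightarrow> bounded_linear T \<and> (\<forall>c x. T (c *\<^sub>C x) = c *\<^sub>C T x)"

text \<open>On a Hilbert space the operator described here exists (Riesz representation theorem) and
  is unique for every bounded operator \<open>T\<close>.\<close>

definition cadjoint :: "('a::chilbert_space \<Rightarrow> 'a) \<Rightarrow> 'a \<Rightarrow> 'a"
  where "cadjoint T =
    (THE U. bounded_clinear U \<and> (\<forall>x y. cinner (T x) y = cinner x (U y)))"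

definition is_moore_penrose :: "('a::chilbert_space \<Rightarrow> 'a) \<Rightarrow> ('a \<Rightarrow> 'a) \<Rightarrow> bool"
  where "is_moore_penrose T X \<longleftrightarrow>
    bounded_clinear X \<and>
    T \<circ> X \<circ> T = T \<and>
    X \<circ> T \<circ> X = X \<and>
    T \<circ> X = cadjoint (T \<circ> X) \<and>
    X \<circ> T = cadjoint (X \<circ> T)"

text \<open>Meaningful for bounded operators with closed range, for which \<open>X\<close> exists and is unique.\<close>

definition moore_penrose :: "('a::chilbert_space \<Rightarrow> 'a) \<Rightarrow> 'a \<Rightarrow> 'a"
  where "moore_penrose T = (THE X. is_moore_penrose T X)"

definition EP_operator :: "('a::chilbert_space \<Rightarrow> 'a) \<Rightarrow> bool"
  where "EP_operator T \<longleftrightarrow>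
    bounded_clinear T \<and> closed (range T) \<and> range T = range (cadjoint T)"

end

theory Submission
  imports Defs
begin

text \<open>
  Write \<open>S'\<close>, \<open>T'\<close> for the Moore-Penrose inverses. The four products \<open>P = S' S\<close>, \<open>P\<^sub>1 = S S'\<close>,
  \<open>Q = T T'\<close>, \<open>Q\<^sub>1 = T' T\<close> are orthogonal projections, and the two identities to be characterised
  read \<open>P T = T P\<^sub>1\<close> and \<open>S Q = Q\<^sub>1 S\<close>. Two general observations reduce the theorem to
  computing with these products.

  First, an operator \<open>A\<close> that has a bounded generalised inverse \<open>X\<close> with \<open>A X A = A\<close> and \<open>A X\<close>,
  \<open>X A\<close> symmetric is EP exactly when \<open>A X = X A\<close>, because these two projections have ranges
  \<open>range A\<close> and \<open>range A\<^sup>*\<close> (\<open>EP_operator_iff_comp_commute\<close>). In particular the range of such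
  an \<open>A\<close> is closed. As a consequence, a symmetric operator that an EP operator absorbs on one side
  is absorbed on the other side too (\<open>EP_operator_absorb_iff\<close>).

  Secondly, \<open>(S T)' = T' S'\<close> makes \<open>P Q\<close> idempotent, and two orthogonal projections with
  idempotent product commute (\<open>symmetric_idempotents_commute\<close>).

  If the two identities hold, then \<open>S T T' S'\<close> and \<open>T' S' S T\<close> both equal \<open>Q\<^sub>1 P\<^sub>1\<close>, so \<open>S T\<close> is EP;
  and \<open>S' T'\<close> is a generalised inverse of \<open>T S\<close> whose products with \<open>T S\<close> on either side both equal
  \<open>P Q\<close>, so \<open>T S\<close> is EP. Conversely, if \<open>S T\<close> is EP, let \<open>F = S T T' S' = T' S' S T\<close>. As \<open>P\<close> and
  \<open>Q\<close> commute, \<open>P T = T F\<close> and \<open>S Q = F S\<close>. If also \<open>T S\<close> is EP, then \<open>T S P = T S\<close> and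
  \<open>Q T S = T S\<close> turn into \<open>P T S = T S\<close> and \<open>T S Q = T S\<close>, and these give \<open>T P\<^sub>1 = T F\<close> and
  \<open>Q\<^sub>1 S = F S\<close>.

  The analytic input is that adjoints and Moore-Penrose inverses exist. Both rest on the Riesz
  representation theorem, stated here for closed subspaces so that it yields orthogonal projections
  as well. Boundedness of the Moore-Penrose inverse comes from the closed graph theorem, which is
  derived from the Baire category theorem.
\<close>

section \<open>The closed graph theorem\<close>

text \<open>The Baire step: the sublevel sets of \<open>norm \<circ> f\<close> cover the space, so the closure of one of
  them contains a ball. Differences of elements of this closure fill a ball around \<open>0\<close>, and scaling
  makes the approximation uniform.\<close>

lemma linear_bounded_approximation:
  fixes f :: "'a::banach \<Rightarrow> 'b::real_normed_vector"
  assumes lin: "linear f"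
  shows "\<exists>C. \<forall>z. \<exists>w. norm (z - w) \<le> norm z / 2 \<and> norm (f w) \<le> C * norm z"
proof -
  interpret f: linear f by fact
  define F where "F n = {y. norm (f y) \<le> real n}" for n :: nat
  have "\<exists>n. interior (closure (F n)) \<noteq> {}"
  proof (rule ccontr)
    assume "\<nexists>n. interior (closure (F n)) \<noteq> {}"
    then have "euclidean interior_of \<Union> (range (\<lambda>n. closure (F n))) = {}"
      by (intro Baire_category_alt) (auto simp: completely_metrizable_space_euclidean)
    moreover have "y \<in> \<Union> (range (\<lambda>n. closure (F n)))" for y
    proof -
      obtain n :: nat where "norm (f y) \<le> real n"
        using real_arch_simple by blast
      then have "y \<in> F n" by (simp add: F_def)
      then show ?thesis using closure_subset by blast
    qed
    then have "\<Union> (range (\<lambda>n. closure (F n))) = UNIV" by blast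
    ultimately show False by simp
  qed
  then obtain n y0 where "y0 \<in> interior (closure (F n))" by blast
  then obtain r where r: "r > 0" "cball y0 r \<subseteq> closure (F n)"
    by (metis mem_interior_cball)
  define C where "C = 2 * real n / r"
  have "\<exists>w. norm (z - w) \<le> norm z / 2 \<and> norm (f w) \<le> C * norm z" for z
  proof (cases "z = 0")
    case True
    then show ?thesis by (auto intro!: exI[of _ 0] simp: f.zero)
  next
    case False
    \<comment> \<open>Scaling by \<open>s\<close> brings \<open>z\<close> to norm \<open>r\<close>; an error of \<open>r/4\<close> at each of the two points then
      becomes \<open>norm z / 2\<close> in total after scaling back.\<close>
    define s where "s = r / norm z"
    have s: "s > 0" using False r by (simp add: s_def)
    have "y0 + s *\<^sub>R z \<in> closure (F n)" "y0 \<in> closure (F n)"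
      using r False by (auto simp: s_def dist_norm intro!: subsetD[OF r(2)])
    moreover have "r / 4 > 0" using r by simp
    ultimately obtain u v where u: "u \<in> F n" "dist u (y0 + s *\<^sub>R z) < r/4"
      and v: "v \<in> F n" "dist v y0 < r/4"
      by (metis closure_approachable)
    define w where "w = (1 / s) *\<^sub>R (u - v)"
    have "z - w = (1 / s) *\<^sub>R ((v - y0) - (u - (y0 + s *\<^sub>R z)))"
      using s by (simp add: w_def algebra_simps)
    then have "norm (z - w) = (1 / s) * norm ((v - y0) - (u - (y0 + s *\<^sub>R z)))"
      using s by simp
    also have "\<dots> \<le> (1 / s) * (r/4 + r/4)"
      using u v s norm_triangle_ineq4[of "v - y0" "u - (y0 + s *\<^sub>R z)"]
      by (intro mult_left_mono) (auto simp: dist_norm)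
    also have "\<dots> = norm z / 2" using r False by (simp add: s_def)
    finally have 1: "norm (z - w) \<le> norm z / 2" .
    have "norm (f w) = (1 / s) * norm (f u - f v)"
      using s by (simp add: w_def f.scaleR f.diff)
    also have "\<dots> \<le> (1 / s) * (real n + real n)"
      using u v s norm_triangle_ineq4[of "f u" "f v"]
      by (intro mult_left_mono) (auto simp: F_def)
    also have "\<dots> = C * norm z" using r False by (simp add: s_def C_def)
    finally show ?thesis using 1 by blast
  qed
  then show ?thesis by blast
qed

text \<open>Approximating \<open>z\<close>, then the remaining error, and so on, writes \<open>z\<close> as a series whose image
  under \<open>f\<close> converges absolutely. The closed graph identifies the sum of the image series with
  \<open>f z\<close>.\<close>

theorem closed_graph_bounded_linear:
  fixes f :: "'a::banach \<Rightarrow> 'b::banach"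
  assumes lin: "linear f"
    and graph: "\<And>u x y. u \<longlonglongrightarrow> x \<Longrightarrow> (\<lambda>n. f (u n)) \<longlonglongrightarrow> y \<Longrightarrow> f x = y"
  shows "bounded_linear f"
proof -
  interpret f: linear f by fact
  obtain C w where w: "\<And>z. norm (z - w z) \<le> norm z / 2" "\<And>z. norm (f (w z)) \<le> C * norm z"
    using linear_bounded_approximation[OF lin] by metis
  have "norm (f z) \<le> norm z * (2 * \<bar>C\<bar>)" for z
  proof -
    define rest where "rest n = ((\<lambda>x. x - w x) ^^ n) z" for n
    have rest_Suc: "rest (Suc n) = rest n - w (rest n)" for n by (simp add: rest_def)
    have rest_le: "norm (rest n) \<le> (1/2) ^ n * norm z" for n
    proof (induction n)
      case 0
      then show ?case by (simp add: rest_def)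
    next
      case (Suc n)
      then show ?case using w(1)[of "rest n"] by (simp add: rest_Suc)
    qed
    have "(\<lambda>n. (1/2) ^ n * norm z) \<longlonglongrightarrow> 0"
      by (intro tendsto_mult_left_zero LIMSEQ_power_zero) simp
    with always_eventually[OF allI[OF rest_le]] have "rest \<longlonglongrightarrow> 0"
      by (rule Lim_null_comparison)
    moreover have partial: "(\<Sum>k<n. w (rest k)) = z - rest n" for n
      by (induction n) (auto simp: rest_Suc, simp add: rest_def)
    ultimately have lim: "(\<lambda>n. \<Sum>k<n. w (rest k)) \<longlonglongrightarrow> z"
      unfolding partial by (auto intro!: tendsto_eq_intros)
    have le: "norm (f (w (rest k))) \<le> (\<bar>C\<bar> * norm z) * (1/2) ^ k" for k
    proof -
      have "norm (f (w (rest k))) \<le> C * norm (rest k)" by (rule w)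
      also have "\<dots> \<le> \<bar>C\<bar> * ((1/2) ^ k * norm z)"
        using rest_le by (intro mult_mono) auto
      finally show ?thesis by (simp add: mult_ac)
    qed
    have geo: "(\<lambda>k. (\<bar>C\<bar> * norm z) * (1/2) ^ k) sums ((\<bar>C\<bar> * norm z) * 2)"
      using sums_mult[OF geometric_sums[of "1/2::real"], of "\<bar>C\<bar> * norm z"] by simp
    have summ: "summable (\<lambda>k. f (w (rest k)))"
      by (rule summable_comparison_test'[OF sums_summable[OF geo] le])
    then have "(\<lambda>n. f (\<Sum>k<n. w (rest k))) \<longlonglongrightarrow> (\<Sum>k. f (w (rest k)))"
      by (simp add: f.sum summable_LIMSEQ)
    with lim have "f z = (\<Sum>k. f (w (rest k)))" by (rule graph)
    also have "norm \<dots> \<le> (\<Sum>k. (\<bar>C\<bar> * norm z) * (1/2) ^ k)"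
      by (rule norm_suminf_le[OF le sums_summable[OF geo]])
    also have "\<dots> = norm z * (2 * \<bar>C\<bar>)" using geo by (simp add: sums_iff mult_ac)
    finally show ?thesis .
  qed
  with lin show ?thesis
    by (auto simp: bounded_linear_def bounded_linear_axioms_def)
qed

section \<open>Inner products and the Riesz representation theorem\<close>

instance chilbert_space \<subseteq> banach ..

lemma cinner_add_right: "cinner x (y + z) = cinner x y + cinner x (z::'a::complex_inner)"
  by (metis cinner_add_left cinner_commute complex_cnj_add)

lemma cinner_scaleC_right: "cinner x (c *\<^sub>C y) = cnj c * cinner x (y::'a::complex_inner)"
  by (metis cinner_scaleC_left cinner_commute complex_cnj_mult)

lemma cinner_scaleR_left: "cinner (r *\<^sub>R x) y = of_real r * cinner x (y::'a::complex_inner)"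
  by (simp add: scaleR_scaleC cinner_scaleC_left)

lemma cinner_scaleR_right: "cinner x (r *\<^sub>R y) = of_real r * cinner x (y::'a::complex_inner)"
  by (simp add: scaleR_scaleC cinner_scaleC_right)

lemma cinner_diff_left: "cinner (x - y) z = cinner x z - cinner y (z::'a::complex_inner)"
  by (metis add_diff_cancel_right' cinner_add_left diff_add_cancel)

lemma cinner_diff_right: "cinner z (x - y) = cinner z x - cinner z (y::'a::complex_inner)"
  by (metis add_diff_cancel_right' cinner_add_right diff_add_cancel)

lemma cinner_zero [simp]:
  "cinner 0 (x::'a::complex_inner) = 0" "cinner (x::'a::complex_inner) 0 = 0"
  using cinner_diff_left[of x x x] cinner_diff_right[of x x x] by simp_all

lemma cinner_self: "cinner x x = of_real ((norm (x::'a::complex_inner))\<^sup>2)"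
proof -
  have "Im (cinner x x) = 0"
    by (metis cinner_commute complex_is_Real_iff Reals_cnj_iff)
  then show ?thesis
    by (simp add: complex_eq_iff norm_eq_sqrt_cinner cinner_ge_zero)
qed

lemma cinner_Cauchy_Schwarz: "cmod (cinner x y) \<le> norm x * norm (y::'a::complex_inner)"
proof (cases "y = 0")
  case False
  define a where "a = cinner x y"
  define n where "n = (norm y)\<^sup>2"
  have n: "n > 0" using False by (simp add: n_def)
  \<comment> \<open>\<open>norm y ^ 2\<close> times the component of \<open>x\<close> orthogonal to \<open>y\<close>\<close>
  let ?z = "of_real n *\<^sub>C x - a *\<^sub>C y"
  have "0 \<le> Re (cinner ?z ?z)" by (rule cinner_ge_zero)
  also have "cinner y x = cnj a" by (simp add: a_def cinner_commute[of y x])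
  then have "cinner ?z ?z = of_real (n * (n * (norm x)\<^sup>2)) - of_real n * (a * cnj a)"
    by (simp add: cinner_diff_left cinner_diff_right cinner_scaleC_left cinner_scaleC_right
        cinner_self[of x] cinner_self[of y] algebra_simps flip: a_def n_def)
  also have "\<dots> = of_real (n * (n * (norm x)\<^sup>2 - (cmod a)\<^sup>2))"
    by (simp add: complex_norm_square[symmetric] algebra_simps)
  finally have "(cmod a)\<^sup>2 \<le> (norm x * norm y)\<^sup>2"
    using n by (simp add: zero_le_mult_iff n_def power_mult_distrib mult_ac)
  then show ?thesis unfolding a_def by (rule power2_le_imp_le) auto
qed simp

lemma bounded_linear_cinner_left: "bounded_linear (\<lambda>x. cinner x (y::'a::complex_inner))"
  by (rule bounded_linear_intro[where K = "norm y"])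
     (auto simp: cinner_add_left cinner_scaleR_left scaleR_conv_of_real cinner_Cauchy_Schwarz)

lemma bounded_linear_cinner_right: "bounded_linear (\<lambda>y. cinner x (y::'a::complex_inner))"
  by (rule bounded_linear_intro[where K = "norm x"])
     (auto simp: cinner_add_right cinner_scaleR_right scaleR_conv_of_real cinner_Cauchy_Schwarz
        mult.commute[of "norm _" "norm x"])

lemma cinner_ext:
  assumes "\<And>z. cinner z x = cinner z (y::'a::complex_inner)" shows "x = y"
proof -
  have "cinner (x - y) (x - y) = 0" using assms by (simp add: cinner_diff_right)
  then show ?thesis by (simp add: cinner_eq_zero_iff)
qed

text \<open>The representing vector minimises \<open>(norm x)\<^sup>2 - 2 * Re (\<phi> x)\<close> over \<open>M\<close>. By the parallelogram
  law a minimising sequence is Cauchy, and varying the minimiser inside \<open>M\<close> gives the representation.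
  For \<open>\<phi> = (\<lambda>y. cinner y x)\<close> it is the orthogonal projection of \<open>x\<close> onto \<open>M\<close>.\<close>

theorem Riesz_representation_closed_subspace:
  fixes M :: "'a::chilbert_space set" and \<phi> :: "'a \<Rightarrow> complex"
  assumes M: "closed M" "0 \<in> M" "\<And>x y. x \<in> M \<Longrightarrow> y \<in> M \<Longrightarrow> x + y \<in> M"
      "\<And>c x. x \<in> M \<Longrightarrow> c *\<^sub>C x \<in> M"
    and phi: "bounded_linear \<phi>" "\<And>c x. \<phi> (c *\<^sub>C x) = c * \<phi> x"
  shows "\<exists>p\<in>M. \<forall>y\<in>M. cinner y p = \<phi> y"
proof -
  interpret phi: bounded_linear \<phi> by fact
  define J where "J x = (norm x)\<^sup>2 - 2 * Re (\<phi> x)" for x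
  have sq: "(norm (x + y))\<^sup>2 = (norm x)\<^sup>2 + (norm y)\<^sup>2 + 2 * Re (cinner y x)" for x y :: 'a
  proof -
    have "complex_of_real ((norm (x + y))\<^sup>2) =
        of_real ((norm x)\<^sup>2) + of_real ((norm y)\<^sup>2) + (cinner y x + cnj (cinner y x))"
      unfolding cinner_self[symmetric] cinner_commute[of x y, symmetric]
      by (simp add: cinner_add_left cinner_add_right)
    from arg_cong[OF this, of Re] show ?thesis by simp
  qed
  have J_add: "J (x + y) = J x + (norm y)\<^sup>2 + 2 * Re (cinner y x - \<phi> y)" for x y
    by (simp add: J_def sq phi.add)
  have MR: "r *\<^sub>R x \<in> M" if "x \<in> M" for r x
    using M(4)[OF that] by (simp add: scaleR_scaleC)
  obtain K where K: "\<And>x. norm (\<phi> x) \<le> norm x * K" using phi.bounded by blast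
  have J_ge: "J x \<ge> - K\<^sup>2" for x
  proof -
    have "J x \<ge> (norm x)\<^sup>2 - 2 * (norm x * K)"
      using K[of x] complex_Re_le_cmod[of "\<phi> x"] by (simp add: J_def)
    moreover have "0 \<le> (norm x - K)\<^sup>2" by simp
    ultimately show ?thesis by (simp add: power2_diff)
  qed
  define m where "m = Inf (J ` M)"
  have bdd: "bdd_below (J ` M)" using J_ge by (auto intro!: bdd_belowI)
  have m_le: "m \<le> J x" if "x \<in> M" for x
    unfolding m_def using bdd that by (auto intro: cInf_lower)
  have "\<exists>x\<in>M. J x < m + inverse (Suc n)" for n
  proof -
    have "Inf (J ` M) < m + inverse (real (Suc n))" by (simp add: m_def)
    then show ?thesis using M(2) cInf_less_iff[OF _ bdd] by blast
  qed
  then obtain u where u: "\<And>n. u n \<in> M" "\<And>n. J (u n) < m + inverse (Suc n)" by metis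
  have par: "(norm (x - y))\<^sup>2 = 2 * J x + 2 * J y - 4 * J ((1/2) *\<^sub>R (x + y))" for x y
  proof -
    have "4 * J ((1/2) *\<^sub>R (x + y)) = (norm (x + y))\<^sup>2 - 4 * Re (\<phi> x) - 4 * Re (\<phi> y)"
      unfolding J_def phi.scaleR phi.add norm_scaleR by (simp add: power_divide field_simps)
    moreover have "(norm (x - y))\<^sup>2 = (norm x)\<^sup>2 + (norm y)\<^sup>2 - 2 * Re (cinner y x)"
      using sq[of x "- y"] by (simp add: cinner_diff_left[of 0 y, simplified])
    ultimately show ?thesis
      using sq[of x y] by (simp add: J_def)
  qed
  have close: "(norm (u i - u j))\<^sup>2 \<le> 2 * inverse (Suc i) + 2 * inverse (Suc j)" for i j
    using par[of "u i" "u j"] u(2)[of i] u(2)[of j] m_le[of "(1/2) *\<^sub>R (u i + u j)"] MR M(3) u(1)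
    by fastforce
  have "Cauchy u"
  proof (rule metric_CauchyI)
    fix e :: real assume "e > 0"
    then have "e\<^sup>2 / 4 > 0" by simp
    then obtain N where N: "inverse (real (Suc N)) < e\<^sup>2 / 4" using reals_Archimedean by blast
    have "dist (u i) (u j) < e" if "i \<ge> N" "j \<ge> N" for i j
    proof -
      have "inverse (real (Suc i)) \<le> inverse (Suc N)" "inverse (real (Suc j)) \<le> inverse (Suc N)"
        using that by (auto intro!: le_imp_inverse_le)
      then have "(norm (u i - u j))\<^sup>2 < e\<^sup>2" using close[of i j] N by linarith
      then show ?thesis using \<open>e > 0\<close> by (simp add: dist_norm power2_less_imp_less)
    qed
    then show "\<exists>N. \<forall>i\<ge>N. \<forall>j\<ge>N. dist (u i) (u j) < e" by blast
  qed
  then obtain p where p: "u \<longlonglongrightarrow> p" using Cauchy_convergent convergent_def by blast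
  have pM: "p \<in> M" using M(1) u(1) p closed_sequentially by blast
  have "(\<lambda>n. J (u n)) \<longlonglongrightarrow> J p"
    unfolding J_def by (intro tendsto_intros p phi.tendsto)
  moreover have "(\<lambda>n. m + inverse (real (Suc n))) \<longlonglongrightarrow> m + 0"
    by (intro tendsto_intros LIMSEQ_inverse_real_of_nat)
  ultimately have "J p \<le> m + 0" using u(2) by (intro LIMSEQ_le) (auto intro: less_imp_le)
  then have p_min: "J p \<le> J x" if "x \<in> M" for x using m_le[OF that] by simp
  have Re_eq: "Re (cinner y p) = Re (\<phi> y)" if y: "y \<in> M" for y
  proof (rule ccontr)
    define d where "d = Re (cinner y p) - Re (\<phi> y)"
    assume "\<not> ?thesis"
    then have d: "d \<noteq> 0" by (simp add: d_def)
    then have "y \<noteq> 0" by (auto simp: d_def phi.zero)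
    then have n: "(norm y)\<^sup>2 > 0" by simp
    \<comment> \<open>the minimiser of the increment \<open>t\<^sup>2 * (norm y)\<^sup>2 + 2 * t * d\<close> of \<open>J\<close> along \<open>y\<close>\<close>
    define t where "t = - d / (norm y)\<^sup>2"
    have "J p \<le> J (p + t *\<^sub>R y)" using p_min M(3) MR pM y by blast
    also have "\<dots> = J p + (t\<^sup>2 * (norm y)\<^sup>2 + 2 * t * d)"
      by (simp add: J_add d_def cinner_scaleR_left phi.scaleR power_mult_distrib algebra_simps)
    also have "t\<^sup>2 * (norm y)\<^sup>2 + 2 * t * d = - d\<^sup>2 / (norm y)\<^sup>2"
      using n by (simp add: t_def field_simps power2_eq_square)
    finally show False using n d by (simp add: divide_le_0_iff)
  qed
  have "cinner y p = \<phi> y" if y: "y \<in> M" for y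
  proof (rule complex_eqI)
    show "Re (cinner y p) = Re (\<phi> y)" by (rule Re_eq[OF y])
    \<comment> \<open>The real part at \<open>\<i> *\<^sub>C y\<close> is, up to sign, the imaginary part at \<open>y\<close>.\<close>
    show "Im (cinner y p) = Im (\<phi> y)"
      using Re_eq[OF M(4)[OF y, of \<i>]] by (simp add: cinner_scaleC_left phi(2))
  qed
  with pM show ?thesis by blast
qed




section \<open>Adjoints and symmetric operators\<close>

lemma bounded_clinear_imp_bounded_linear: "bounded_clinear T \<Longrightarrow> bounded_linear T"
  by (simp add: bounded_clinear_def)

lemma bounded_clinear_scaleC: "bounded_clinear T \<Longrightarrow> T (c *\<^sub>C x) = c *\<^sub>C T x"
  by (simp add: bounded_clinear_def)

lemma bounded_clinear_compose:
  "bounded_clinear S \<Longrightarrow> bounded_clinear T \<Longrightarrow> bounded_clinear (S \<circ> T)"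
  unfolding bounded_clinear_def comp_def by (auto intro: bounded_linear_compose)

text \<open>The value of the adjoint at \<open>y\<close> represents the bounded functional \<open>\<lambda>x. cinner (T x) y\<close>.\<close>

theorem ex_cadjoint:
  fixes T :: "'a::chilbert_space \<Rightarrow> 'a"
  assumes T: "bounded_clinear T"
  shows "\<exists>U. bounded_clinear U \<and> (\<forall>x y. cinner (T x) y = cinner x (U y))"
proof -
  interpret T: bounded_linear T using T by (rule bounded_clinear_imp_bounded_linear)
  have "\<exists>p\<in>UNIV. \<forall>x\<in>UNIV. cinner x p = cinner (T x) y" for y
    by (intro Riesz_representation_closed_subspace
        bounded_linear_compose[OF bounded_linear_cinner_left T.bounded_linear_axioms])
       (auto simp: bounded_clinear_scaleC[OF T] cinner_scaleC_left)
  then obtain U where U: "\<And>x y. cinner x (U y) = cinner (T x) y" by (metis UNIV_I)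
  obtain K where K: "K > 0" "\<And>x. norm (T x) \<le> norm x * K" using T.pos_bounded by blast
  have "bounded_linear U"
  proof (rule bounded_linear_intro)
    fix x y show "U (x + y) = U x + U y"
      by (rule cinner_ext) (simp add: U cinner_add_right)
  next
    fix r x show "U (r *\<^sub>R x) = r *\<^sub>R U x"
      by (rule cinner_ext) (simp add: U cinner_scaleR_right)
  next
    fix y show "norm (U y) \<le> norm y * K"
    proof (cases "U y = 0")
      case False
      have "complex_of_real ((norm (U y))\<^sup>2) = cinner (T (U y)) y"
        using U[of "U y" y] cinner_self[of "U y"] by simp
      then have "(norm (U y))\<^sup>2 = cmod (cinner (T (U y)) y)"
        by (metis abs_of_nonneg norm_of_real zero_le_power2)
      also have "\<dots> \<le> norm (T (U y)) * norm y" by (rule cinner_Cauchy_Schwarz)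
      also have "\<dots> \<le> norm (U y) * K * norm y" using K by (intro mult_right_mono) auto
      finally show ?thesis using False by (simp add: power2_eq_square mult_ac)
    qed (use K in simp)
  qed
  moreover have "U (c *\<^sub>C x) = c *\<^sub>C U x" for c x
    by (rule cinner_ext) (simp add: U cinner_scaleC_right)
  ultimately show ?thesis using U by (auto simp: bounded_clinear_def)
qed

lemma cadjoint_eqI:
  assumes "bounded_clinear U" and "\<And>x y. cinner (T x) y = cinner x (U y)"
  shows "cadjoint T = U"
  unfolding cadjoint_def
proof (rule the_equality)
  fix V assume "bounded_clinear V \<and> (\<forall>x y. cinner (T x) y = cinner x (V y))"
  then show "V = U" using assms(2) by (metis cinner_ext ext)
qed (use assms in auto)

lemma cinner_cadjoint:
  assumes "bounded_clinear T"
  shows "cinner (T x) y = cinner x (cadjoint T y)"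
proof -
  obtain U where U: "bounded_clinear U" "\<And>x y. cinner (T x) y = cinner x (U y)"
    using ex_cadjoint[OF assms] by blast
  then show ?thesis by (simp add: cadjoint_eqI[OF U])
qed

text \<open>For bounded operators this is self-adjointness, in a form that can be used without the
  definite description behind \<open>cadjoint\<close>.\<close>

definition symmetric_op :: "('a::complex_inner \<Rightarrow> 'a) \<Rightarrow> bool"
  where "symmetric_op E \<longleftrightarrow> (\<forall>x y. cinner (E x) y = cinner x (E y))"

lemma eq_cadjoint_iff_symmetric_op:
  assumes "bounded_clinear E"
  shows "E = cadjoint E \<longleftrightarrow> symmetric_op E"
proof
  assume eq: "E = cadjoint E"
  show "symmetric_op E"
    using cinner_cadjoint[OF assms, folded eq] by (simp add: symmetric_op_def)
next
  assume "symmetric_op E"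
  then show "E = cadjoint E"
    using cadjoint_eqI[OF assms, of E] by (simp add: symmetric_op_def)
qed

text \<open>Taking adjoints in \<open>E F = G\<close> reverses the product.\<close>

lemma symmetric_op_comp_swap:
  assumes "symmetric_op E" "symmetric_op F" "symmetric_op G" "E \<circ> F = G"
  shows "F \<circ> E = G"
proof (rule ext, rule cinner_ext)
  fix x z
  have "cinner z ((F \<circ> E) x) = cinner ((E \<circ> F) z) x"
    using assms(1,2) by (simp add: symmetric_op_def)
  also have "\<dots> = cinner z (G x)" using assms(3,4) by (simp add: symmetric_op_def)
  finally show "cinner z ((F \<circ> E) x) = cinner z (G x)" .
qed

text \<open>An orthogonal projection is determined by its range: the two equations say that each operator
  fixes the range of the other.\<close>

lemma symmetric_op_eqI:
  assumes "symmetric_op E" "symmetric_op F" "E \<circ> F = F" "F \<circ> E = E"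
  shows "E = F"
  using symmetric_op_comp_swap[OF assms(1,2,2,3)] assms(4) by simp

text \<open>If \<open>E = P Q\<close> is idempotent, expanding the square shows \<open>norm (E x - Q E x) = 0\<close>. Hence
  \<open>P Q = Q P Q\<close>, and the right-hand side is symmetric.\<close>

lemma symmetric_idempotents_commute:
  assumes sym: "symmetric_op P" "symmetric_op Q"
    and idem: "P \<circ> P = P" "Q \<circ> Q = Q" "(P \<circ> Q) \<circ> (P \<circ> Q) = P \<circ> Q"
  shows "P \<circ> Q = Q \<circ> P"
proof -
  have move: "cinner (P x) y = cinner x (P y)" "cinner (Q x) y = cinner x (Q y)" for x y
    using sym by (simp_all add: symmetric_op_def)
  have PP: "P (P x) = P x" and QQ: "Q (Q x) = Q x" and PQPQ: "P (Q (P (Q x))) = P (Q x)" for x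
    using idem by (simp_all add: fun_eq_iff)
  have PQ: "P (Q x) = Q (P (Q x))" for x
  proof -
    let ?d = "P (Q x) - Q (P (Q x))"
    have "cinner ?d ?d = 0"
      by (simp add: cinner_diff_left cinner_diff_right move PP QQ PQPQ)
    then show ?thesis by (simp add: cinner_eq_zero_iff)
  qed
  have "P (Q x) = Q (P x)" for x
  proof (rule cinner_ext)
    fix z
    have "cinner z (P (Q x)) = cinner (Q (P (Q z))) x"
      by (subst PQ) (simp add: move)
    also have "\<dots> = cinner (P (Q z)) x" by (simp flip: PQ)
    also have "\<dots> = cinner z (Q (P x))" by (simp add: move)
    finally show "cinner z (P (Q x)) = cinner z (Q (P x))" .
  qed
  then show ?thesis by (simp add: fun_eq_iff)
qed

section \<open>Existence and uniqueness of the Moore-Penrose inverse\<close>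

lemma is_moore_penrose_iff:
  assumes "bounded_clinear T"
  shows "is_moore_penrose T X \<longleftrightarrow> bounded_clinear X \<and> T \<circ> X \<circ> T = T \<and> X \<circ> T \<circ> X = X \<and>
    symmetric_op (T \<circ> X) \<and> symmetric_op (X \<circ> T)"
  unfolding is_moore_penrose_def
  by (intro conj_cong refl eq_cadjoint_iff_symmetric_op bounded_clinear_compose assms)

lemma moore_penroseD:
  assumes "bounded_clinear T" "is_moore_penrose T X"
  shows "bounded_clinear X" "T \<circ> X \<circ> T = T" "X \<circ> T \<circ> X = X"
    "symmetric_op (T \<circ> X)" "symmetric_op (X \<circ> T)"
  using assms by (auto simp only: is_moore_penrose_iff)

lemma is_moore_penrose_unique:
  fixes T X Y :: "'a::chilbert_space \<Rightarrow> 'a"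
  assumes T: "bounded_clinear T" and X: "is_moore_penrose T X" and Y: "is_moore_penrose T Y"
  shows "X = Y"
proof -
  note X = moore_penroseD[OF T X] and Y = moore_penroseD[OF T Y]
  have "T \<circ> X = T \<circ> Y"
    by (rule symmetric_op_eqI) (simp_all only: X Y o_assoc)
  moreover have "(X \<circ> T) \<circ> (Y \<circ> T) = X \<circ> T" "(Y \<circ> T) \<circ> (X \<circ> T) = Y \<circ> T"
    by (simp_all only: comp_assoc X(2)[unfolded comp_assoc] Y(2)[unfolded comp_assoc])
  then have "X \<circ> T = Y \<circ> T"
    by (metis symmetric_op_comp_swap[OF X(5) Y(5) X(5)])
  ultimately have "X \<circ> T \<circ> X = Y \<circ> T \<circ> Y" by (simp only: comp_assoc)
  then show ?thesis by (simp only: X(3) Y(3))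
qed

lemma closed_null_space:
  fixes f :: "'a::real_normed_vector \<Rightarrow> 'b::real_normed_vector"
  shows "bounded_linear f \<Longrightarrow> closed {x. f x = 0}"
  by (intro closed_Collect_eq linear_continuous_on continuous_on_const)

lemma ex_orthogonal_projection:
  fixes M :: "'a::chilbert_space set"
  assumes "closed M" "0 \<in> M" "\<And>x y. x \<in> M \<Longrightarrow> y \<in> M \<Longrightarrow> x + y \<in> M"
    "\<And>c x. x \<in> M \<Longrightarrow> c *\<^sub>C x \<in> M"
  shows "\<exists>p\<in>M. \<forall>y\<in>M. cinner y (x - p) = 0"
proof -
  have "\<exists>p\<in>M. \<forall>y\<in>M. cinner y p = cinner y x"
    using assms by (intro Riesz_representation_closed_subspace bounded_linear_cinner_left)
      (auto simp: cinner_scaleC_left)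
  then obtain p where "p \<in> M" "\<forall>y\<in>M. cinner y p = cinner y x" by blast
  then show ?thesis by (intro bexI[of _ p]) (simp_all add: cinner_diff_right)
qed

text \<open>The value of the inverse at \<open>y\<close> is the least-squares solution \<open>x\<close> of \<open>T x = y\<close> orthogonal to
  the null space of \<open>T\<close>. It exists because the range and the null space are closed, and it is unique,
  hence linear in \<open>y\<close>. Its defining conditions are equations between continuous functions of \<open>x\<close> and
  \<open>y\<close>, so its graph is closed.\<close>

theorem ex_moore_penrose:
  fixes T :: "'a::chilbert_space \<Rightarrow> 'a"
  assumes T: "bounded_clinear T" and closed: "closed (range T)"
  shows "\<exists>X. is_moore_penrose T X"
proof -
  interpret T: bounded_linear T using T by (rule bounded_clinear_imp_bounded_linear)
  note TC = bounded_clinear_scaleC[OF T]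
  define normal_sol where
    "normal_sol y x \<longleftrightarrow> (\<forall>z. T z = 0 \<longrightarrow> cinner z x = 0) \<and> (\<forall>z. cinner (T z) (y - T x) = 0)" for y x
  have "\<exists>x. normal_sol y x" for y
  proof -
    have "\<exists>p\<in>range T. \<forall>w\<in>range T. cinner w (y - p) = 0"
    proof (intro ex_orthogonal_projection closed)
      show "0 \<in> range T" using T.zero by (metis rangeI)
    next
      fix a b assume "a \<in> range T" "b \<in> range T"
      then show "a + b \<in> range T" by (auto simp flip: T.add)
    next
      fix c a assume "a \<in> range T"
      then show "c *\<^sub>C a \<in> range T" by (auto simp flip: TC)
    qed
    then obtain u where u: "\<And>z. cinner (T z) (y - T u) = 0" by blast
    have "\<exists>q\<in>{x. T x = 0}. \<forall>z\<in>{x. T x = 0}. cinner z (u - q) = 0"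
    proof (intro ex_orthogonal_projection closed_null_space T.bounded_linear_axioms)
      have "c *\<^sub>C (0::'a) = 0" for c by (metis cinner_scaleC_left cinner_zero(1) cinner_eq_zero_iff mult_zero_right)
      then show "c *\<^sub>C x \<in> {x. T x = 0}" if "x \<in> {x. T x = 0}" for c x
        using that by (simp add: TC)
    qed (auto simp: T.add T.zero)
    then obtain q where "T q = 0" "\<And>z. T z = 0 \<Longrightarrow> cinner z (u - q) = 0" by blast
    then have "normal_sol y (u - q)" using u by (simp add: normal_sol_def T.diff)
    then show ?thesis by blast
  qed
  then obtain X where X: "\<And>y. normal_sol y (X y)" by metis
  have unique: "x = X y" if "normal_sol y x" for x y
  proof -
    have "cinner (T z) (T (x - X y)) = 0" for z
      using that X[of y] by (simp add: normal_sol_def T.diff cinner_diff_right)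
    then have "T (x - X y) = 0" using cinner_eq_zero_iff by blast
    then have "cinner (x - X y) (x - X y) = 0"
      using that X[of y] by (simp add: normal_sol_def cinner_diff_right)
    then show ?thesis by (simp add: cinner_eq_zero_iff)
  qed
  have XC: "X (c *\<^sub>C y) = c *\<^sub>C X y" for c y
  proof (rule unique[symmetric])
    have "cinner (T z) (c *\<^sub>C y - T (c *\<^sub>C X y)) = cnj c * cinner (T z) (y - T (X y))" for z
      by (simp add: TC cinner_diff_right cinner_scaleC_right algebra_simps)
    then show "normal_sol (c *\<^sub>C y) (c *\<^sub>C X y)"
      using X[of y] by (simp add: normal_sol_def cinner_scaleC_right)
  qed
  have "linear X"
  proof (rule linearI)
    fix a b
    have "T (X a + X b) = T (X a) + T (X b)" by (rule T.add)
    then have "normal_sol (a + b) (X a + X b)"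
      using X[of a] X[of b] by (simp add: normal_sol_def cinner_diff_right cinner_add_right)
    then show "X (a + b) = X a + X b" by (rule unique[symmetric])
  qed (simp add: scaleR_scaleC XC)
  moreover have "X y = x" if u: "u \<longlonglongrightarrow> y" and Xu: "(\<lambda>n. X (u n)) \<longlonglongrightarrow> x" for u y x
  proof (rule unique[symmetric])
    note cr = bounded_linear.tendsto[OF bounded_linear_cinner_right]
    have "cinner z x = 0" if "T z = 0" for z
      using cr[OF Xu, of z] X that by (auto simp: normal_sol_def LIMSEQ_const_iff)
    moreover have "cinner (T z) (y - T x) = 0" for z
      using cr[OF tendsto_diff[OF u T.tendsto[OF Xu]], of "T z"] X
      by (auto simp: normal_sol_def LIMSEQ_const_iff)
    ultimately show "normal_sol y x" by (simp add: normal_sol_def)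
  qed
  ultimately have "bounded_linear X" by (rule closed_graph_bounded_linear)
  then have bX: "bounded_clinear X" by (simp add: bounded_clinear_def XC)
  have TXT: "T (X (T z)) = T z" for z
  proof -
    have "cinner (T z - T (X (T z))) (T z - T (X (T z))) = 0"
      using X[of "T z"] by (simp add: normal_sol_def flip: T.diff)
    then show ?thesis by (simp add: cinner_eq_zero_iff)
  qed
  have orth_range: "cinner (T w) y = cinner (T w) (T (X y))" for w y
    using X[of y] by (simp add: normal_sol_def cinner_diff_right)
  have orth_null: "cinner w (X y) = cinner (X (T w)) (X y)" for w y
  proof -
    have "T (w - X (T w)) = 0" by (simp add: T.diff TXT)
    then have "cinner (w - X (T w)) (X y) = 0" using X[of y] by (simp add: normal_sol_def)
    then show ?thesis by (simp add: cinner_diff_left)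
  qed
  have sym: "symmetric_op (T \<circ> X)" "symmetric_op (X \<circ> T)"
    unfolding symmetric_op_def comp_def using orth_range orth_null cinner_commute by metis+
  have XTX: "X (T (X y)) = X y" for y
  proof (rule unique)
    show "normal_sol y (X (T (X y)))" using X[of y] X[of "T (X y)"] by (simp add: normal_sol_def TXT)
  qed
  have "is_moore_penrose T X"
    using bX TXT XTX sym by (simp add: is_moore_penrose_iff[OF T] fun_eq_iff)
  then show ?thesis by blast
qed

corollary moore_penrose:
  assumes "bounded_clinear T" and "closed (range T)"
  shows "is_moore_penrose T (moore_penrose T)"
proof -
  obtain X where X: "is_moore_penrose T X" using ex_moore_penrose[OF assms] by blast
  then have "moore_penrose T = X"
    unfolding moore_penrose_def using is_moore_penrose_unique[OF assms(1) _ X] by (rule the_equality)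
  with X show ?thesis by simp
qed

section \<open>EP operators through generalised inverses\<close>

text \<open>The two symmetric idempotents \<open>A X\<close> and \<open>X A\<close> are the projections onto \<open>range A\<close> and the range
  of the adjoint of \<open>A\<close>, so the ranges agree exactly when the products do. As the set of fixed
  points of a continuous map, \<open>range A\<close> is automatically closed.\<close>

lemma EP_operator_iff_comp_commute:
  fixes A X :: "'a::chilbert_space \<Rightarrow> 'a"
  assumes A: "bounded_clinear A" and X: "bounded_clinear X" and AXA: "A \<circ> X \<circ> A = A"
    and sym: "symmetric_op (A \<circ> X)" "symmetric_op (X \<circ> A)"
  shows "EP_operator A \<longleftrightarrow> A \<circ> X = X \<circ> A"
proof -
  have AXA': "A (X (A x)) = A x" for x using AXA by (metis comp_apply)
  have range: "range A = {y. A (X y) = y}"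
    by (auto simp: AXA' intro: range_eqI[OF HOL.sym])
  have range_adj: "range (cadjoint A) = {y. X (A y) = y}"
  proof (intro equalityI subsetI CollectI)
    fix y assume "y \<in> range (cadjoint A)"
    then obtain w where y: "y = cadjoint A w" by blast
    have "cinner z (X (A y)) = cinner z y" for z
    proof -
      have "cinner z (X (A y)) = cinner (X (A z)) y" using sym(2) by (simp add: symmetric_op_def)
      also have "\<dots> = cinner z y" by (simp add: y AXA' flip: cinner_cadjoint[OF A])
      finally show ?thesis .
    qed
    then show "X (A y) = y" by (rule cinner_ext)
  next
    fix y assume "y \<in> {y. X (A y) = y}"
    then have y: "X (A y) = y" by simp
    have "cinner z (cadjoint A (cadjoint X y)) = cinner z y" for z
      using sym(2) y by (simp add: symmetric_op_def flip: cinner_cadjoint[OF A] cinner_cadjoint[OF X])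
    then have "cadjoint A (cadjoint X y) = y" by (rule cinner_ext)
    then show "y \<in> range (cadjoint A)" by (metis rangeI)
  qed
  note ranges = range range_adj
  have "continuous_on UNIV (\<lambda>y. A (X y))"
    using bounded_clinear_compose[OF A X]
    by (auto simp: bounded_clinear_def comp_def intro: linear_continuous_on)
  then have closed: "closed (range A)"
    unfolding range by (intro closed_Collect_eq continuous_on_id)
  show ?thesis
  proof
    assume "EP_operator A"
    then have fixes_eq: "A (X y) = y \<longleftrightarrow> X (A y) = y" for y
      unfolding EP_operator_def ranges by blast
    show "A \<circ> X = X \<circ> A"
    proof (rule symmetric_op_eqI[OF sym])
      show "(A \<circ> X) \<circ> (X \<circ> A) = X \<circ> A" "(X \<circ> A) \<circ> (A \<circ> X) = A \<circ> X"
        using AXA' fixes_eq[of "X (A _)"] fixes_eq[of "A (X _)"] by (simp_all add: fun_eq_iff)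
    qed
  next
    assume "A \<circ> X = X \<circ> A"
    then have "range A = range (cadjoint A)" unfolding ranges by (simp add: fun_eq_iff)
    with A closed show "EP_operator A" by (simp add: EP_operator_def)
  qed
qed

text \<open>Let \<open>N\<close> be the Moore-Penrose inverse of \<open>B\<close> and \<open>G = N B = B N\<close>. Absorption of \<open>E\<close> by \<open>B\<close>
  on either side is absorption of \<open>E\<close> by \<open>G\<close> on that side, and for the symmetric \<open>G\<close> the two
  sides are equivalent.\<close>

lemma EP_operator_absorb_iff:
  fixes B E :: "'a::chilbert_space \<Rightarrow> 'a"
  assumes EP: "EP_operator B" and E: "symmetric_op E"
  shows "B \<circ> E = B \<longleftrightarrow> E \<circ> B = B"
proof -
  have B: "bounded_clinear B" "closed (range B)" using EP unfolding EP_operator_def by blast+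
  obtain N where mp: "is_moore_penrose B N" using ex_moore_penrose[OF B] by blast
  note N = moore_penroseD[OF B(1) mp]
  have comm: "B \<circ> N = N \<circ> B" using EP EP_operator_iff_comp_commute[OF B(1) N(1,2,4,5)] by blast
  show ?thesis
  proof
    assume BE: "B \<circ> E = B"
    have "(N \<circ> B) \<circ> E = N \<circ> B" by (simp only: comp_assoc BE)
    from symmetric_op_comp_swap[OF N(5) E N(5) this]
    have EG: "E \<circ> (N \<circ> B) = N \<circ> B" .
    have "(N \<circ> B) \<circ> B = B" using N(2) by (simp only: comm)
    then show "E \<circ> B = B" by (metis EG comp_assoc)
  next
    assume EB: "E \<circ> B = B"
    have "E \<circ> (B \<circ> N) = B \<circ> N" by (simp only: o_assoc EB)
    from symmetric_op_comp_swap[OF E N(4,4) this]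
    have GE: "(B \<circ> N) \<circ> E = B \<circ> N" .
    have "B \<circ> (B \<circ> N) = B" by (simp only: comm) (simp only: o_assoc N(2))
    then show "B \<circ> E = B" by (metis GE comp_assoc)
  qed
qed

section \<open>The characterisation\<close>

theorem theorem4p6:
  fixes S T :: "'a::chilbert_space \<Rightarrow> 'a"
  assumes "bounded_clinear S" and "bounded_clinear T"
    and "closed (range S)" and "closed (range T)" and "closed (range (S \<circ> T))"
    and "moore_penrose (S \<circ> T) = moore_penrose T \<circ> moore_penrose S"
  shows "EP_operator (S \<circ> T) \<and> EP_operator (T \<circ> S) \<longleftrightarrow>
    moore_penrose S \<circ> S \<circ> T = T \<circ> S \<circ> moore_penrose S \<and>
    S \<circ> T \<circ> moore_penrose T = moore_penrose T \<circ> T \<circ> S"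
proof -
  define S' where "S' = moore_penrose S"
  define T' where "T' = moore_penrose T"
  note clin = assms(1,2) bounded_clinear_compose[OF assms(1,2)] bounded_clinear_compose[OF assms(2,1)]
  note MPS = moore_penroseD[OF assms(1) moore_penrose[OF assms(1,3)], folded S'_def]
  note MPT = moore_penroseD[OF assms(2) moore_penrose[OF assms(2,4)], folded T'_def]
  have "is_moore_penrose (S \<circ> T) (T' \<circ> S')"
    using moore_penrose[OF clin(3) assms(5)] assms(6) by (simp add: S'_def T'_def)
  note MPA = moore_penroseD[OF clin(3) this]
  have S: "S (S' (S x)) = S x" "S' (S (S' x)) = S' x" for x
    using MPS(2,3) by (simp_all add: fun_eq_iff)
  have T: "T (T' (T x)) = T x" "T' (T (T' x)) = T' x" for x
    using MPT(2,3) by (simp_all add: fun_eq_iff)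
  have A: "S (T (T' (S' (S (T x))))) = S (T x)" for x
    using MPA(2) by (simp add: fun_eq_iff)
  \<comment> \<open>\<open>P Q\<close> is idempotent: multiply \<open>S T T' S' S T = S T\<close> by \<open>S'\<close> on the left and \<open>T'\<close> on the right.\<close>
  have PQ: "(S' \<circ> S) \<circ> (T \<circ> T') = (T \<circ> T') \<circ> (S' \<circ> S)"
    by (rule symmetric_idempotents_commute) (simp_all add: MPS MPT fun_eq_iff S T A)
  then have comm: "S' (S (T (T' x))) = T (T' (S' (S x)))" for x
    by (simp add: fun_eq_iff)
  have EP_ST: "EP_operator (S \<circ> T) \<longleftrightarrow> (\<forall>x. S (T (T' (S' x))) = T' (S' (S (T x))))"
    using EP_operator_iff_comp_commute[OF clin(3) MPA(1,2,4,5)] by (simp add: fun_eq_iff)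
  have "EP_operator (S \<circ> T) \<and> EP_operator (T \<circ> S) \<longleftrightarrow>
    (\<forall>x. S' (S (T x)) = T (S (S' x))) \<and> (\<forall>x. S (T (T' x)) = T' (T (S x)))" (is "_ \<longleftrightarrow> ?R")
  proof
    assume EP: "EP_operator (S \<circ> T) \<and> EP_operator (T \<circ> S)"
    then have F: "S (T (T' (S' x))) = T' (S' (S (T x)))" for x using EP_ST by blast
    \<comment> \<open>With \<open>F\<close> for either side of the previous equation: \<open>P T = T F\<close> and \<open>S Q = F S\<close>.\<close>
    have PT: "S' (S (T x)) = T (T' (S' (S (T x))))" for x
      by (metis comm T(1))
    have SQ: "S (T (T' x)) = S (T (T' (S' (S x))))" for x
      by (metis comm S(1))
    have "(T \<circ> S) \<circ> (S' \<circ> S) = T \<circ> S" by (simp add: fun_eq_iff S)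
    then have "(S' \<circ> S) \<circ> (T \<circ> S) = T \<circ> S"
      using EP_operator_absorb_iff[OF _ MPS(5)] EP by blast
    then have PTS: "S' (S (T (S x))) = T (S x)" for x by (simp add: fun_eq_iff)
    have "(T \<circ> T') \<circ> (T \<circ> S) = T \<circ> S" by (simp add: fun_eq_iff T)
    then have "(T \<circ> S) \<circ> (T \<circ> T') = T \<circ> S"
      using EP_operator_absorb_iff[OF _ MPT(4)] EP by blast
    then have TSQ: "T (S (T (T' x))) = T (S x)" for x by (simp add: fun_eq_iff)
    have "S' (S (T x)) = T (S (S' x))" for x
    proof -
      have "T (S (S' x)) = S' (S (T (S (S' x))))" by (simp only: PTS)
      also have "\<dots> = T (S (T (T' (S' (S (S' x))))))" by (simp only: F PT[symmetric])
      also have "\<dots> = T (T' (S' (S (T x))))" by (simp only: S F)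
      finally show ?thesis by (simp only: PT[symmetric])
    qed
    moreover have "S (T (T' x)) = T' (T (S x))" for x
    proof -
      have "T' (T (S x)) = T' (T (S (T (T' x))))" by (simp only: TSQ)
      also have "\<dots> = T' (T (T' (S' (S (T (S x))))))" by (subst SQ) (simp only: F)
      also have "\<dots> = S (T (T' (S' (S x))))" by (simp only: T F)
      finally show ?thesis by (simp only: SQ[symmetric])
    qed
    ultimately show ?R by blast
  next
    assume ?R
    then have h1: "S' (S (T x)) = T (S (S' x))" and h2: "S (T (T' x)) = T' (T (S x))" for x
      by blast+
    have "EP_operator (S \<circ> T)" unfolding EP_ST by (simp add: h1 h2)
    moreover
    have BX: "(T \<circ> S) \<circ> (S' \<circ> T') = (S' \<circ> S) \<circ> (T \<circ> T')" by (simp add: fun_eq_iff h1)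
    have XB: "(S' \<circ> T') \<circ> (T \<circ> S) = (S' \<circ> S) \<circ> (T \<circ> T')" by (simp add: fun_eq_iff flip: h2)
    have sym: "symmetric_op ((S' \<circ> S) \<circ> (T \<circ> T'))"
    proof -
      have "cinner (S' (S (T (T' x)))) y = cinner x (S' (S (T (T' y))))" for x y
        using MPS(5) MPT(4) by (simp add: symmetric_op_def flip: comm)
      then show ?thesis by (simp add: symmetric_op_def)
    qed
    have "EP_operator (T \<circ> S)"
    proof (subst EP_operator_iff_comp_commute)
      show "bounded_clinear (S' \<circ> T')" by (rule bounded_clinear_compose[OF MPS(1) MPT(1)])
      show "(T \<circ> S) \<circ> (S' \<circ> T') \<circ> (T \<circ> S) = T \<circ> S"
        unfolding BX by (simp add: fun_eq_iff T h1 S)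
    qed (simp_all only: BX XB sym clin)
    ultimately show "EP_operator (S \<circ> T) \<and> EP_operator (T \<circ> S)" by blast
  qed
  then show ?thesis by (simp add: S'_def T'_def fun_eq_iff)
qed

end
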